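(* For integers $i,j,k,l\ge 0$ let $\mu_{i,j}^{k,l}=-\mu_{j,i}^{k,l}$ and $\beta_i^{k,l}$ be real numbers. Set $Pf(i,j)^{k,l}=\mu_{i,j}^{k,l}$, $Pf(d_0,i)^{k,l}=\beta_i^{k,l}$, $Pf(d_1,i)^{k,l}=\beta_{i+1}^{k,l}$, $Pf(d_0,d_1)^{k,l}=0$, and assume $$\mu_{i,j}^{k+1,l}=\mu_{i,j}^{k,l}+Pf(d_0,d_1,i,j)^{k,l},\qquad \beta_i^{k+1,l}=\beta_{i+1}^{k,l}+\beta_i^{k,l},$$ $$\mu_{i,j}^{k,l+1}=\mu_{i,j}^{k,l}+\mu_{i+1,j}^{k,l}+\mu_{i,j+1}^{k,l}+\mu_{i+1,j+1}^{k,l},\qquad \beta_i^{k,l+1}=\beta_{i+1}^{k,l}+\beta_i^{k,l}.$$ Define $$\tau_{2n}^{k,l}=Pf(0,1,\dots,2n-1)^{k,l},\qquad \tau_{2n+1}^{k,l}=Pf(d_0,0,1,\dots,2n)^{k,l},$$ and assume $\tau_n^{k,l}\neq 0$ for all $n,k,l\ge0$. Then $$v_n^{k,l}=\frac{\tau_{n+1}^{k,l}}{\tau_n^{k,l}},\qquad u_n^{k,l}=\frac{\tau_n^{k+1,l}}{\tau_n^{k,l}},\qquad w_n^{k,l}=\frac{\tau_n^{k,l+1}}{\tau_n^{k,l}}$$ satisfy, for all $n,k,l\ge 0$, the full-discrete 3D B-Toda lattice $$v_n^{k+1,l}u_n^{k,l}=v_n^{k,l}u_{n+1}^{k,l},\qquad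 v_n^{k,l+1}w_n^{k,l}=v_n^{k,l}w_{n+1}^{k,l},\qquad \frac{u_{n+1}^{k,l+1}}{u_{n+1}^{k,l}}=1+\frac{v_{n+1}^{k,l}w_n^{k+1,l}}{w_{n+1}^{k,l}v_n^{k+1,l}}-\frac{v_{n+1}^{k+1,l}}{v_n^{k,l+1}}.$$
   Context: Hirota's Pfaffian notation: given symbols $a_1,\dots,a_{2N}$ and prescribed entries $Pf(a_i,a_j)=-Pf(a_j,a_i)$, $Pf(a_1,\dots,a_{2N})$ denotes the Pfaffian of the $2N\times 2N$ skew-symmetric matrix with $(i,j)$ entry $Pf(a_i,a_j)$; the empty Pfaffian is $1$ (so $\tau_0^{k,l}=1$). Superscripts on $Pf$ indicate that the entries with those superscripts are used. In particular $Pf(d_0,d_1,i,j)^{k,l}=\beta_{i+1}^{k,l}\beta_j^{k,l}-\beta_i^{k,l}\beta_{j+1}^{k,l}$. *)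

theory Defs
  imports Complex_Main "HOL-Combinatorics.Permutations"
begin

text \<open>The Pfaffian of the skew-symmetric \<open>2N \<times> 2N\<close> matrix \<open>(A i j)\<close> with \<open>i, j < 2 * N\<close>
  (rows and columns numbered from 0). Skew-symmetry is not part of the definition.\<close>

definition pfaffian :: "nat \<Rightarrow> (nat \<Rightarrow> nat \<Rightarrow> real) \<Rightarrow> real" where
  "pfaffian N A =
     (\<Sum>p | p permutes {..<2 * N}. of_int (sign p) * (\<Prod>i<N. A (p (2 * i)) (p (2 * i + 1))))
       / (2 ^ N * fact N)"

datatype symb = D0 | D1 | Ix nat

fun entry :: "(nat \<Rightarrow> nat \<Rightarrow> real) \<Rightarrow> (nat \<Rightarrow> real) \<Rightarrow> symb \<Rightarrow> symb \<Rightarrow> real" where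
  "entry m b (Ix i) (Ix j) = m i j"
| "entry m b D0 (Ix i) = b i"
| "entry m b D1 (Ix i) = b (i + 1)"
| "entry m b (Ix i) D0 = - b i"
| "entry m b (Ix i) D1 = - b (i + 1)"
| "entry m b D0 D0 = 0"
| "entry m b D0 D1 = 0"
| "entry m b D1 D0 = 0"
| "entry m b D1 D1 = 0"

text \<open>Hirota's \<open>Pf(a\<^sub>1, \<dots>, a\<^sub>2\<^sub>N)\<close>, with entries determined by \<open>m\<close> and \<open>b\<close>. Only lists of even
  length are meaningful; the value 0 at odd length is a convention.\<close>

definition Pf :: "(nat \<Rightarrow> nat \<Rightarrow> real) \<Rightarrow> (nat \<Rightarrow> real) \<Rightarrow> symb list \<Rightarrow> real" where
  "Pf m b as =
     (if even (length as)
      then pfaffian (length as div 2) (\<lambda>i j. entry m b (as ! i) (as ! j))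
      else 0)"

lemma Pf_Nil: "Pf m b [] = 1"
  by (simp add: Pf_def pfaffian_def)

lemma sum_sign_permutes_insert:
  fixes F :: "(nat \<Rightarrow> nat) \<Rightarrow> real"
  assumes "finite S" "a \<notin> S"
  shows "(\<Sum>p | p permutes insert a S. of_int (sign p) * F p) =
    (\<Sum>b\<in>insert a S. (if a = b then 1 else - 1) *
       (\<Sum>q | q permutes S. of_int (sign q) * F (transpose a b \<circ> q)))"
proof -
  have *: "of_int (sign (transpose a b \<circ> q)) * F (transpose a b \<circ> q) =
      (if a = b then 1 else - 1) * (of_int (sign q) * F (transpose a b \<circ> q))"
    if "q permutes S" for b q
    using that assms(1) permutation_permutes[of q]
    by (auto simp: sign_compose permutation_swap_id sign_swap_id)
  show ?thesis
    unfolding sum_over_permutations_insert[OF assms] sum_distrib_left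
    by (intro sum.cong refl, rule *) simp
qed

lemma Pf_d0_d1:
  assumes "\<And>i j. m i j = - m j i"
  shows "Pf m b [D0, D1, Ix i, Ix j] = b (i + 1) * b j - b i * b (j + 1)"
proof -
  have s: "{..<2 * 2::nat} = {0, 1, 2, 3}" by auto
  have e: "(\<Prod>i<2. f i) = f 0 * f 1" for f :: "nat \<Rightarrow> real"
    by (simp add: numeral_2_eq_2)
  have m: "m j i = - m i j" using assms .
  define G where "G = (\<lambda>r s t u.
    entry m b ([D0, D1, Ix i, Ix j] ! r) ([D0, D1, Ix i, Ix j] ! s) *
    entry m b ([D0, D1, Ix i, Ix j] ! t) ([D0, D1, Ix i, Ix j] ! u))"
  have "pfaffian 2 (\<lambda>r s. entry m b ([D0, D1, Ix i, Ix j] ! r) ([D0, D1, Ix i, Ix j] ! s)) =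
      (\<Sum>p | p permutes {0, 1, 2, 3}. of_int (sign p) * G (p 0) (p 1) (p 2) (p 3)) / 8"
    unfolding pfaffian_def e s G_def by simp
  also have "\<dots> = b (i + 1) * b j - b i * b (j + 1)"
    by (simp add: sum_sign_permutes_insert Transposition.transpose_def del: One_nat_def)
      (simp add: G_def m algebra_simps numeral_3_eq_3)
  finally show ?thesis by (simp add: Pf_def flip: numeral_2_eq_2)
qed

end

theory Submission
  imports Defs
begin

text \<open>The first two equations are immediate cancellations; the third one is the bilinear identity
  \<open>\<tau>\<^sub>n\<^sub>+\<^sub>1\<^bsup>k+1,l+1\<^esup> \<tau>\<^sub>n\<^sub>+\<^sub>1\<^bsup>k,l\<^esup> =
    \<tau>\<^sub>n\<^sub>+\<^sub>1\<^bsup>k,l+1\<^esup> \<tau>\<^sub>n\<^sub>+\<^sub>1\<^bsup>k+1,l\<^esup>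
    + \<tau>\<^sub>n\<^sub>+\<^sub>2\<^bsup>k,l\<^esup> \<tau>\<^sub>n\<^bsup>k+1,l+1\<^esup> - \<tau>\<^sub>n\<^sub>+\<^sub>2\<^bsup>k+1,l\<^esup> \<tau>\<^sub>n\<^bsup>k,l+1\<^esup>\<close>.
  All its terms are Pfaffians at the fixed point \<open>(k, l)\<close>. The step in \<open>k\<close> is a rank-two update of
  the matrix: it turns \<open>Pf(S)\<close> into \<open>Pf(S) + Pf(d\<^sub>0, d\<^sub>1, S)\<close> and \<open>Pf(d\<^sub>0, S)\<close> into
  \<open>Pf(d\<^sub>0, S) + Pf(d\<^sub>1, S)\<close>. The step in \<open>l\<close> replaces every index \<open>i\<close> by the formal sum
  \<open>i + (i + 1)\<close>; with an extra symbol \<open>c\<close> such that \<open>Pf(c, i) = (- 1)\<^sup>i\<close>, row operations give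
  \<open>Pf(0 + 1, \<dots>, (n - 1) + n) = Pf(c, 0, \<dots>, n)\<close>. The bilinear identity then becomes a four-term
  Pfaffian Pluecker relation in \<open>d\<^sub>0\<close>, \<open>d\<^sub>1\<close>, \<open>c\<close> and the last index.\<close>

section \<open>Alternating sums over the entries of a list\<close>

text \<open>An index-free form of the expansion of a Pfaffian along a row: \<open>g\<close> receives
  the removed entry and the remaining list in its order. Structural induction then replaces
  bookkeeping with positions; \<open>alt_sum_eq_sum\<close> gives the indexed form.\<close>

primrec alt_sum :: "('a \<Rightarrow> 'a list \<Rightarrow> real) \<Rightarrow> 'a list \<Rightarrow> real" where
  "alt_sum g [] = 0"
| "alt_sum g (y # ys) = g y ys - alt_sum (\<lambda>z zs. g z (y # zs)) ys"

text \<open>The length condition in the second premise is what makes the recursive calls of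
  \<open>pf\<close> below visibly terminating.\<close>

lemma alt_sum_cong [fundef_cong]:
  assumes "xs = ys"
    and "\<And>z zs. z \<in> set ys \<Longrightarrow> set zs \<subseteq> set ys \<Longrightarrow> length ys = Suc (length zs) \<Longrightarrow> g z zs = h z zs"
  shows "alt_sum g xs = alt_sum h ys"
proof -
  have "alt_sum g ys = alt_sum h ys"
    using assms(2)
  proof (induction ys arbitrary: g h)
    case Nil
    then show ?case by simp
  next
    case (Cons y ys)
    have "g y ys = h y ys"
      by (rule Cons.prems) auto
    moreover have "alt_sum (\<lambda>z zs. g z (y # zs)) ys = alt_sum (\<lambda>z zs. h z (y # zs)) ys"
      by (rule Cons.IH, rule Cons.prems) auto
    ultimately show ?case by simp
  qed
  with assms(1) show ?thesis by simp
qed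

lemma alt_sum_zero: "(\<And>z zs. z \<in> set xs \<Longrightarrow> g z zs = 0) \<Longrightarrow> alt_sum g xs = 0"
  by (induction xs arbitrary: g) auto

lemma alt_sum_add: "alt_sum (\<lambda>z zs. g z zs + h z zs) xs = alt_sum g xs + alt_sum h xs"
  by (induction xs arbitrary: g h) auto

lemma alt_sum_diff: "alt_sum (\<lambda>z zs. g z zs - h z zs) xs = alt_sum g xs - alt_sum h xs"
  by (induction xs arbitrary: g h) auto

lemma alt_sum_mult_left: "alt_sum (\<lambda>z zs. c * g z zs) xs = c * alt_sum g xs"
  by (induction xs arbitrary: g) (auto simp: algebra_simps)

lemma alt_sum_negf: "alt_sum (\<lambda>z zs. - g z zs) xs = - alt_sum g xs"
  by (induction xs arbitrary: g) auto

lemma alt_sum_map: "alt_sum g (map f xs) = alt_sum (\<lambda>z zs. g (f z) (map f zs)) xs"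
  by (induction xs arbitrary: g) auto

lemma alt_sum_snoc:
  "alt_sum g (xs @ [x]) = alt_sum (\<lambda>z zs. g z (zs @ [x])) xs + (- 1) ^ length xs * g x xs"
  by (induction xs arbitrary: g) auto

lemma alt_sum_swap:
  "alt_sum (\<lambda>x xs'. alt_sum (\<lambda>y ys'. G x xs' y ys') ys) xs =
   alt_sum (\<lambda>y ys'. alt_sum (\<lambda>x xs'. G x xs' y ys') xs) ys"
  by (induction xs arbitrary: G) (auto simp: alt_sum_diff alt_sum_zero)

text \<open>Removing the same two entries in either order leaves the same list, but the signs are
  opposite, since removing the earlier entry first shifts the later one by one position.\<close>

lemma alt_sum_nested_skew:
  "alt_sum (\<lambda>z zs. alt_sum (\<lambda>w ws. G z w ws) zs) xs =
   - alt_sum (\<lambda>z zs. alt_sum (\<lambda>w ws. G w z ws) zs) xs"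
proof (induction xs arbitrary: G)
  case (Cons y ys)
  show ?case
    using Cons.IH[of "\<lambda>z w ws. G z w (y # ws)"] by (simp add: alt_sum_diff)
qed simp

text \<open>The terms that remove \<open>a\<close> or \<open>b\<close> are interchanged, and their
  signs differ because the positions are adjacent; all other terms are covered by the assumption on
  \<open>g\<close>.\<close>

lemma alt_sum_transpose_adjacent:
  assumes "\<And>z us vs. Suc (length us + length vs) = length xs + length ys \<Longrightarrow>
      g z (us @ a # b # vs) = - g z (us @ b # a # vs)"
  shows "alt_sum g (xs @ a # b # ys) = - alt_sum g (xs @ b # a # ys)"
  using assms
proof (induction xs arbitrary: g)
  case Nil
  have "alt_sum (\<lambda>z zs. g z (a # b # zs)) ys = alt_sum (\<lambda>z zs. (- 1) * g z (b # a # zs)) ys"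
    by (rule alt_sum_cong) (use Nil[of "[]"] in auto)
  then show ?case
    by (simp only: alt_sum_mult_left) simp
next
  case (Cons x xs)
  have "alt_sum (\<lambda>z zs. g z (x # zs)) (xs @ a # b # ys) =
      - alt_sum (\<lambda>z zs. g z (x # zs)) (xs @ b # a # ys)"
    by (rule Cons.IH) (use Cons.prems[of "x # _"] in auto)
  then show ?case
    using Cons.prems[of xs ys x] by simp
qed

lemma alt_sum_eq_sum:
  "alt_sum g xs = (\<Sum>i<length xs. (- 1) ^ i * g (xs ! i) (take i xs @ drop (Suc i) xs))"
  by (induction xs arbitrary: g)
    (simp_all add: sum.lessThan_Suc_shift sum_negf del: sum.lessThan_Suc)

section \<open>Pfaffians of lists by expansion along the first symbol\<close>

fun pf :: "('a \<Rightarrow> 'a \<Rightarrow> real) \<Rightarrow> 'a list \<Rightarrow> real" where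
  "pf e [] = 1"
| "pf e (x # xs) = alt_sum (\<lambda>y ys. e x y * pf e ys) xs"

lemma pf_map: "pf e (map f xs) = pf (\<lambda>x y. e (f x) (f y)) xs"
proof (induction xs rule: length_induct)
  case (1 xs)
  then show ?case
    by (cases xs) (auto simp: alt_sum_map intro!: alt_sum_cong)
qed

lemma pf_cong:
  assumes "\<And>x y. x \<in> set xs \<Longrightarrow> y \<in> set xs \<Longrightarrow> e x y = e' x y"
  shows "pf e xs = pf e' xs"
  using assms
proof (induction xs rule: length_induct)
  case (1 xs)
  show ?case
  proof (cases xs)
    case (Cons x ys)
    have "e x z * pf e zs = e' x z * pf e' zs"
      if "z \<in> set ys" "set zs \<subseteq> set ys" "length ys = Suc (length zs)" for z zs
    proof -
      have "pf e zs = pf e' zs"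
        using that Cons "1.IH"[rule_format, of zs] "1.prems" by (simp add: subset_iff)
      then show ?thesis
        using that Cons "1.prems" by simp
    qed
    with Cons show ?thesis
      by (auto intro: alt_sum_cong)
  qed simp
qed

lemma pf_odd: "odd (length xs) \<Longrightarrow> pf e xs = 0"
proof (induction xs rule: length_induct)
  case (1 xs)
  then obtain x ys where xs: "xs = x # ys" by (cases xs) auto
  have "alt_sum (\<lambda>y ys. e x y * pf e ys) ys = alt_sum (\<lambda>y ys. 0) ys"
    by (rule alt_sum_cong) (use 1 xs in auto)
  with xs show ?case by (simp add: alt_sum_zero)
qed

lemma pf_Cons_map_cong:
  assumes "\<And>x. x \<in> set xs \<Longrightarrow> e' z (g x) = e c (f x)"
    and "\<And>x y. x \<in> set xs \<Longrightarrow> y \<in> set xs \<Longrightarrow> e' (g x) (g y) = e (f x) (f y)"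
  shows "pf e' (z # map g xs) = pf e (c # map f xs)"
  unfolding pf.simps alt_sum_map pf_map
  by (intro alt_sum_cong refl arg_cong2[where f = "(*)"] pf_cong) (use assms in \<open>auto simp: subset_iff\<close>)

text \<open>Two transpositions split off the images of the two largest points, leaving a permutation
  that fixes both; this lowers the size of the matrix by two.\<close>

lemma sum_sign_permutes_lessThan_Suc_Suc:
  fixes F :: "(nat \<Rightarrow> nat) \<Rightarrow> real"
  shows "(\<Sum>p | p permutes {..<Suc (Suc M)}. of_int (sign p) * F p) =
    (\<Sum>b\<in>insert (Suc M) {..<Suc M}. (if Suc M = b then 1 else - 1) *
      (\<Sum>c\<in>insert M {..<M}. (if M = c then 1 else - 1) *
        (\<Sum>q | q permutes {..<M}. of_int (sign q) *
           F (transpose (Suc M) b \<circ> (transpose M c \<circ> q)))))"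
  unfolding lessThan_Suc[of "Suc M"]
  by (subst sum_sign_permutes_insert, simp, simp)
    (unfold lessThan_Suc[of M], subst sum_sign_permutes_insert, simp_all)

section \<open>Antisymmetry and linearity of Pfaffians\<close>

context
  fixes e :: "'a \<Rightarrow> 'a \<Rightarrow> real"
  assumes skew: "\<And>x y. e x y = - e y x"
begin

text \<open>If the pair leads the list, two expansions give a nested sum that is antisymmetric by
  \<open>alt_sum_nested_skew\<close>, plus a term in \<open>e a b\<close>. Otherwise one expansion
  along the first symbol reduces to shorter lists.\<close>

lemma pf_transpose_adjacent: "pf e (xs @ a # b # ys) = - pf e (xs @ b # a # ys)"
proof (induction "length xs + length ys" arbitrary: xs ys rule: less_induct)
  case less
  show ?case
  proof (cases xs)
    case Nil
    show ?thesis
      using alt_sum_nested_skew[of "\<lambda>z w ws. e a z * (e b w * pf e ws)" ys]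
      by (simp add: Nil skew[of b a] alt_sum_mult_left[symmetric] mult.left_commute)
  next
    case (Cons x us)
    show ?thesis
      unfolding Cons append_Cons pf.simps
      by (rule alt_sum_transpose_adjacent) (use Cons less in auto)
  qed
qed

lemma pf_move: "pf e (xs @ a # ys @ zs) = (- 1) ^ length ys * pf e (xs @ ys @ a # zs)"
proof (induction ys arbitrary: xs)
  case (Cons y ys)
  show ?case
    using pf_transpose_adjacent[of xs a y "ys @ zs"] Cons.IH[of "xs @ [y]"] by simp
qed simp

lemma pf_repeated: "pf e (xs @ a # ys @ a # zs) = 0"
  using pf_move[of xs a ys "a # zs"] pf_transpose_adjacent[of "xs @ ys" a a zs] by simp

lemma pf_repeated_Cons: "a \<in> set xs \<Longrightarrow> pf e (a # xs) = 0"
  using pf_repeated[of "[]" a] by (auto simp: in_set_conv_decomp simp del: pf.simps)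

lemma pf_exchange: "pf e (xs @ a # ys @ b # zs) = - pf e (xs @ b # ys @ a # zs)"
  using pf_move[of xs a "ys @ [b]" zs] pf_move[of xs b ys "a # zs"] by simp

lemma pf_add:
  assumes "\<And>z. z \<in> set (xs @ ys) \<Longrightarrow> e a z = e b z + e c z"
  shows "pf e (xs @ a # ys) = pf e (xs @ b # ys) + pf e (xs @ c # ys)"
proof -
  have "pf e (a # xs @ ys) = alt_sum (\<lambda>z zs. e b z * pf e zs + e c z * pf e zs) (xs @ ys)"
    unfolding pf.simps by (rule alt_sum_cong) (use assms in \<open>auto simp: algebra_simps\<close>)
  also have "\<dots> = pf e (b # xs @ ys) + pf e (c # xs @ ys)"
    by (simp add: alt_sum_add)
  finally show ?thesis
    using pf_move[of "[]" _ xs ys] by (simp del: pf.simps flip: distrib_left)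
qed

section \<open>Pluecker relations\<close>

text \<open>Expanding the factor that receives the moved symbol in both sums yields the same double sum,
  up to the sign coming from skew-symmetry.\<close>

lemma pf_pluecker:
  "alt_sum (\<lambda>x xs'. pf e xs' * pf e (x # ys)) xs + alt_sum (\<lambda>y ys'. pf e ys' * pf e (y # xs)) ys = 0"
proof -
  have "alt_sum (\<lambda>y ys'. pf e ys' * pf e (y # xs)) ys =
      alt_sum (\<lambda>y ys'. alt_sum (\<lambda>x xs'. pf e ys' * (e y x * pf e xs')) xs) ys"
    by (simp add: alt_sum_mult_left)
  also have "\<dots> = alt_sum (\<lambda>x xs'. alt_sum (\<lambda>y ys'. pf e ys' * (e y x * pf e xs')) ys) xs"
    by (rule alt_sum_swap)
  also have "\<dots> = alt_sum (\<lambda>x xs'. alt_sum (\<lambda>y ys'. - (pf e xs' * (e x y * pf e ys'))) ys) xs"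
    by (intro alt_sum_cong refl) (subst skew, simp)
  also have "\<dots> = - alt_sum (\<lambda>x xs'. pf e xs' * pf e (x # ys)) xs"
    by (simp add: alt_sum_negf alt_sum_mult_left)
  finally show ?thesis
    by simp
qed

text \<open>In \<open>pf_pluecker\<close> for \<open>xs\<close> and
  \<open>a # b # c # xs @ [x]\<close>, moving a symbol of \<open>xs\<close> creates a repetition, so
  only the moves of \<open>a\<close>, \<open>b\<close>, \<open>c\<close> and \<open>x\<close>
  survive.\<close>

lemma pf_pluecker_odd:
  assumes "odd (length xs)"
  shows "pf e (b # c # xs @ [x]) * pf e (a # xs) - pf e (a # c # xs @ [x]) * pf e (b # xs)
    + pf e (a # b # xs @ [x]) * pf e (c # xs) - pf e (a # b # c # xs) * pf e (xs @ [x]) = 0"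
proof -
  have "alt_sum (\<lambda>y ys'. pf e ys' * pf e (y # a # b # c # xs @ [x])) xs = 0"
    by (rule alt_sum_zero) (simp add: pf_repeated_Cons del: pf.simps)
  moreover have "alt_sum (\<lambda>y ys'. pf e (a # b # c # ys' @ [x]) * pf e (y # xs)) xs = 0"
    by (rule alt_sum_zero) (simp add: pf_repeated_Cons del: pf.simps)
  moreover have "pf e (x # xs) = - pf e (xs @ [x])"
    using pf_move[of "[]" x xs "[]"] assms by simp
  ultimately show ?thesis
    using pf_pluecker[of xs "a # b # c # xs @ [x]"] assms
    by (simp add: alt_sum_snoc del: pf.simps)
qed

text \<open>The same argument with \<open>x\<close> attached to the other list, so that both lists
  again have odd length.\<close>

lemma pf_pluecker_even:
  assumes "even (length xs)"
  shows "pf e (a # b # c # xs @ [x]) * pf e xs = pf e (c # xs @ [x]) * pf e (a # b # xs)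
    + pf e (a # xs @ [x]) * pf e (b # c # xs) - pf e (b # xs @ [x]) * pf e (a # c # xs)"
proof -
  have "alt_sum (\<lambda>y ys'. pf e (ys' @ [x]) * pf e (y # a # b # c # xs)) xs = 0"
    by (rule alt_sum_zero) (simp add: pf_repeated_Cons del: pf.simps)
  moreover have "alt_sum (\<lambda>y ys'. pf e (a # b # c # ys') * pf e (y # xs @ [x])) xs = 0"
    by (rule alt_sum_zero) (simp add: pf_repeated_Cons del: pf.simps)
  moreover have "pf e (x # a # b # c # xs) = - pf e (a # b # c # xs @ [x])"
    using pf_move[of "[]" x "a # b # c # xs" "[]"] assms by (simp del: pf.simps)
  ultimately show ?thesis
    using pf_pluecker[of "xs @ [x]" "a # b # c # xs"] assms
    by (simp add: alt_sum_snoc del: pf.simps) (simp add: algebra_simps del: pf.simps)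
qed

section \<open>Rank-two updates: the step in \<open>k\<close>\<close>

text \<open>These are the expansions of Pfaffians that start with \<open>d0, d0, d1\<close> or
  \<open>d1, d0, d1\<close>; the first two terms drop out because \<open>d0\<close> and
  \<open>d1\<close> have zero entries with each other and with themselves.\<close>

lemma alt_sum_pf_repeated:
  assumes "e d0 d1 = 0"
  shows "alt_sum (\<lambda>z zs. e d0 z * pf e (d0 # d1 # zs)) xs = 0"
    and "alt_sum (\<lambda>z zs. e d1 z * pf e (d0 # d1 # zs)) xs = 0"
proof -
  have 0: "e d1 d0 = 0" "e d0 d0 = 0" "e d1 d1 = 0"
    using skew[of d1 d0] skew[of d0 d0] skew[of d1 d1] assms by auto
  show "alt_sum (\<lambda>z zs. e d0 z * pf e (d0 # d1 # zs)) xs = 0"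
    using pf_repeated_Cons[of d0 "d0 # d1 # xs"]
    unfolding pf.simps(2)[of _ d0 "d0 # d1 # xs"] by (simp add: assms 0 del: pf.simps)
  show "alt_sum (\<lambda>z zs. e d1 z * pf e (d0 # d1 # zs)) xs = 0"
    using pf_repeated_Cons[of d1 "d0 # d1 # xs"]
    unfolding pf.simps(2)[of _ d1 "d0 # d1 # xs"] by (simp add: assms 0 del: pf.simps)
qed

text \<open>The terms quadratic in the update vanish, being expansions of Pfaffians with a repeated symbol.\<close>

lemma pf_rank_two_update:
  assumes "e d0 d1 = 0"
  defines "e' \<equiv> \<lambda>x y. e x y + e d1 x * e d0 y - e d0 x * e d1 y"
  shows "pf e' xs = pf e xs + pf e (d0 # d1 # xs)"
proof (induction xs rule: length_induct)
  case (1 xs)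
  show ?case
  proof (cases xs)
    case Nil
    then show ?thesis by (simp add: assms(1))
  next
    case (Cons x ys)
    have "pf e' xs = alt_sum (\<lambda>z zs. (e x z * pf e zs + e x z * pf e (d0 # d1 # zs))
        + (e d1 x * (e d0 z * pf e zs) - e d0 x * (e d1 z * pf e zs))
        + (e d1 x * (e d0 z * pf e (d0 # d1 # zs)) - e d0 x * (e d1 z * pf e (d0 # d1 # zs)))) ys"
      unfolding Cons pf.simps(2)[of e' x]
    proof (intro alt_sum_cong refl)
      fix z :: 'a and zs :: "'a list"
      assume "length ys = Suc (length zs)"
      then have "pf e' zs = pf e zs + pf e (d0 # d1 # zs)"
        using "1.IH"[rule_format, of zs] Cons by simp
      then show "e' x z * pf e' zs = (e x z * pf e zs + e x z * pf e (d0 # d1 # zs))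
        + (e d1 x * (e d0 z * pf e zs) - e d0 x * (e d1 z * pf e zs))
        + (e d1 x * (e d0 z * pf e (d0 # d1 # zs)) - e d0 x * (e d1 z * pf e (d0 # d1 # zs)))"
        by (simp add: e'_def algebra_simps del: pf.simps)
    qed
    also have "\<dots> = pf e xs + (alt_sum (\<lambda>z zs. e x z * pf e (d0 # d1 # zs)) ys
        + e d1 x * pf e (d0 # ys) - e d0 x * pf e (d1 # ys))"
      by (simp only: alt_sum_add alt_sum_diff alt_sum_mult_left alt_sum_pf_repeated[OF assms(1)])
        (simp add: Cons)
    \<comment> \<open>Expanding along \<open>x\<close> in front of \<open>d0, d1\<close> produces
      the last two summands as its first two terms; moving \<open>x\<close> past both symbols costs
      no sign.\<close>
    also have "alt_sum (\<lambda>z zs. e x z * pf e (d0 # d1 # zs)) ys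
        + e d1 x * pf e (d0 # ys) - e d0 x * pf e (d1 # ys) = pf e (x # d0 # d1 # ys)"
      unfolding pf.simps(2)[of _ x "d0 # d1 # ys"]
      by (simp add: skew[of x] del: pf.simps)
    also have "\<dots> = pf e (d0 # d1 # xs)"
      using pf_move[of "[]" x "[d0, d1]" ys] Cons by (simp del: pf.simps)
    finally show ?thesis .
  qed
qed

lemma pf_rank_two_update_map:
  assumes "e d0 d1 = 0"
    and "\<And>x y. e' (g x) (g y) = e (f x) (f y) + e d1 (f x) * e d0 (f y) - e d0 (f x) * e d1 (f y)"
  shows "pf e' (map g xs) = pf e (map f xs) + pf e (d0 # d1 # map f xs)"
  unfolding pf_rank_two_update[OF assms(1), symmetric]
  by (simp add: pf_map assms(2))

text \<open>The row of \<open>z\<close> is the sum of those of \<open>d0\<close> and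
  \<open>d1\<close> rather than a rank-two update, so it is expanded separately. The corrections in
  \<open>d0 # d1 # ys\<close> vanish by \<open>alt_sum_pf_repeated\<close>.\<close>

lemma pf_rank_two_update_Cons_map:
  assumes "e d0 d1 = 0"
    and "\<And>x y. e' (g x) (g y) = e (f x) (f y) + e d1 (f x) * e d0 (f y) - e d0 (f x) * e d1 (f y)"
    and "\<And>x. e' z (g x) = e d0 (f x) + e d1 (f x)"
  shows "pf e' (z # map g xs) = pf e (d0 # map f xs) + pf e (d1 # map f xs)"
proof -
  have "pf e' (z # map g xs) = alt_sum (\<lambda>y ys. (e d0 y * pf e ys + e d1 y * pf e ys)
      + (e d0 y * pf e (d0 # d1 # ys) + e d1 y * pf e (d0 # d1 # ys))) (map f xs)"
    unfolding pf.simps(2)[of e' z] alt_sum_map pf_rank_two_update_map[where e' = e' and f = f and g = g, OF assms(1,2)] assms(3)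
    by (intro alt_sum_cong refl) (simp add: algebra_simps del: pf.simps)
  then show ?thesis
    by (simp only: alt_sum_add alt_sum_pf_repeated[OF assms(1)]) simp
qed

section \<open>Sums of neighbouring symbols: the step in \<open>l\<close>\<close>

lemma pf_consecutive_sums:
  assumes c: "\<And>i. e c (x i) = (- 1) ^ i" "\<And>z. z \<in> set us \<Longrightarrow> e c z = 0"
    and y: "\<And>i z. e (y i) z = e (x i) z + e (x (Suc i)) z"
  shows "pf e (c # us @ map x [0..<Suc n]) = (- 1) ^ length us * pf e (us @ map y [0..<n])"
proof -
  \<comment> \<open>Adding \<open>x (j + 1)\<close>, which is still in the list, to
    \<open>x j\<close> leaves the Pfaffian unchanged. The finished \<open>y j\<close> then joins the
    prefix, hence the generalization over \<open>vs\<close>.\<close>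
  have step: "pf e (vs @ map x [j..<Suc n]) = pf e (vs @ map y [j..<n] @ [x n])" if "j \<le> n" for j vs
    using that
  proof (induction j arbitrary: vs rule: inc_induct)
    case (step j)
    have "[j..<Suc n] = j # [Suc j..<Suc n]" "[Suc j..<Suc n] = Suc j # [Suc (Suc j)..<Suc n]"
      "[j..<n] = j # [Suc j..<n]"
      using step.hyps by (auto simp: upt_conv_Cons simp del: upt_Suc)
    moreover from this(2) have "pf e (vs @ x (Suc j) # map x [Suc j..<Suc n]) = 0"
      using pf_repeated[of vs "x (Suc j)" "[]"] by (simp del: upt_Suc)
    ultimately have "pf e (vs @ map x [j..<Suc n]) = pf e ((vs @ [y j]) @ map x [Suc j..<Suc n])"
      using pf_add[of vs "map x [Suc j..<Suc n]" "y j" "x j" "x (Suc j)"] y by (simp del: upt_Suc)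
    also have "\<dots> = pf e ((vs @ [y j]) @ map y [Suc j..<n] @ [x n])"
      by (rule step.IH)
    finally show ?case
      using \<open>[j..<n] = j # [Suc j..<n]\<close> by simp
  qed simp
  \<comment> \<open>The alternating entries of \<open>c\<close> cancel on each \<open>y i\<close>,
    so expanding along \<open>c\<close> leaves only the term of \<open>x n\<close>, whose entry
    \<open>(- 1) ^ n\<close> absorbs the sign coming from the \<open>n\<close> sums before
    it.\<close>
  have "e c (y i) = 0" for i
    using y[of i c] c(1)[of i] c(1)[of "Suc i"] by (simp add: skew[of _ c])
  then have "alt_sum (\<lambda>z zs. e c z * pf e (zs @ [x n])) (us @ map y [0..<n]) = 0"
    by (intro alt_sum_zero) (auto simp: c(2))
  then have "pf e (c # (us @ map y [0..<n]) @ [x n]) = (- 1) ^ length us * pf e (us @ map y [0..<n])"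
    unfolding pf.simps alt_sum_snoc by (simp add: c(1) power_add)
  with step[of 0 "c # us"] show ?thesis
    by (simp del: upt_Suc pf.simps)
qed

text \<open>Both relations are the Pluecker relations for the list \<open>X (Suc n)\<close> with the
  further symbols \<open>d0\<close>, \<open>d1\<close>, \<open>c\<close> and
  \<open>x (Suc n)\<close>. A factor containing \<open>c\<close> turns into one in \<open>Y\<close>
  that is one symbol shorter; the others stay in \<open>X\<close>.\<close>

lemma pf_pluecker_consecutive_sums:
  assumes c: "\<And>i. e c (x i) = (- 1) ^ i" "e c d0 = 0" "e c d1 = 0"
    and y: "\<And>i z. e (y i) z = e (x i) z + e (x (Suc i)) z"
  defines "X \<equiv> \<lambda>n. map x [0..<n]" and "Y \<equiv> \<lambda>n. map y [0..<n]"
  shows "even n \<Longrightarrow> pf e (d1 # Y (Suc n)) * pf e (d0 # X (Suc n)) - pf e (d0 # Y (Suc n)) * pf e (d1 # X (Suc n))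
      + pf e (d0 # d1 # X (Suc (Suc n))) * pf e (Y n) - pf e (d0 # d1 # Y n) * pf e (X (Suc (Suc n))) = 0"
    and "odd n \<Longrightarrow> pf e (d0 # d1 # Y (Suc n)) * pf e (X (Suc n)) = pf e (Y (Suc n)) * pf e (d0 # d1 # X (Suc n))
      + pf e (d0 # X (Suc (Suc n))) * pf e (d1 # Y n) - pf e (d1 # X (Suc (Suc n))) * pf e (d0 # Y n)"
proof -
  have X: "X (Suc N) = X N @ [x N]" for N
    by (simp add: X_def)
  have len: "length (X N) = N" for N
    by (simp add: X_def)
  have 0: "pf e (c # X (Suc N)) = pf e (Y N)" for N
    using pf_consecutive_sums[of c x "[]" y N] assms by (simp del: pf.simps upt_Suc)
  have 1: "pf e (d # c # X (Suc N)) = pf e (d # Y N)" if "d = d0 \<or> d = d1" for d N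
    using pf_consecutive_sums[of c x "[d]" y N] pf_transpose_adjacent[of "[]" c d "X (Suc N)"] assms that
    by (auto simp del: pf.simps upt_Suc)
  have 2: "pf e (d0 # d1 # c # X (Suc N)) = pf e (d0 # d1 # Y N)" for N
    using pf_consecutive_sums[of c x "[d0, d1]" y N] pf_move[of "[]" c "[d0, d1]" "X (Suc N)"] assms
    by (auto simp del: pf.simps upt_Suc)
  note 0 [simp] 1 [simp] 2 [simp] pf.simps [simp del]
  show "pf e (d1 # Y (Suc n)) * pf e (d0 # X (Suc n)) - pf e (d0 # Y (Suc n)) * pf e (d1 # X (Suc n))
      + pf e (d0 # d1 # X (Suc (Suc n))) * pf e (Y n) - pf e (d0 # d1 # Y n) * pf e (X (Suc (Suc n))) = 0"
    if "even n"
    using pf_pluecker_odd[of "X (Suc n)" d1 c "x (Suc n)" d0] that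
    unfolding X[of "Suc n", symmetric] by (simp add: len)
  show "pf e (d0 # d1 # Y (Suc n)) * pf e (X (Suc n)) = pf e (Y (Suc n)) * pf e (d0 # d1 # X (Suc n))
      + pf e (d0 # X (Suc (Suc n))) * pf e (d1 # Y n) - pf e (d1 # X (Suc (Suc n))) * pf e (d0 # Y n)"
    if "odd n"
    using pf_pluecker_even[of "X (Suc n)" d0 d1 c "x (Suc n)"] that
    unfolding X[of "Suc n", symmetric] by (simp add: len)
qed

end

section \<open>Agreement with the sum over permutations\<close>

text \<open>The recursion of the permutation sum behind \<open>pfaffian\<close> removes the last two positions by
  transpositions; this is the matching expansion of \<open>pf\<close>.\<close>

lemma pf_expand_last:
  fixes A :: "nat \<Rightarrow> nat \<Rightarrow> real"
  assumes skew: "\<And>i j. A i j = - A j i" and "even M"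
  shows "(\<Sum>c\<in>insert M {..<M}. (if M = c then 1 else - 1) *
      (A (transpose M c M) (Suc M) * pf A (map (transpose M c) [0..<M]))) = pf A [0..<Suc (Suc M)]"
proof -
  \<comment> \<open>The transposition puts \<open>M\<close> into place \<open>c\<close>. Moving it
    back to the end passes \<open>M - c - 1\<close> symbols, and \<open>M\<close> is even.\<close>
  have remove: "(if M = c then 1 else - 1) * pf A (map (transpose M c) [0..<M]) =
      (- 1) ^ c * pf A ([0..<c] @ [Suc c..<Suc M])" if "c \<le> M" for c
  proof (cases "c = M")
    case False
    with that have "c < M" by simp
    then have upt: "[0..<M] = [0..<c] @ c # [Suc c..<M]"
      using upt_add_eq_append[of 0 c "M - c"] by (simp add: upt_conv_Cons)
    have "map (transpose M c) [0..<M] = [0..<c] @ M # [Suc c..<M]"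
      unfolding upt using \<open>c < M\<close>
      by (auto simp: transpose_def intro!: map_idI)
    moreover have "(- 1::real) ^ (M - Suc c) = - ((- 1) ^ c)"
      using \<open>c < M\<close> \<open>even M\<close> by (simp add: minus_one_power_iff)
    ultimately show ?thesis
      using pf_move[of A "[0..<c]" M "[Suc c..<M]" "[]", OF skew] \<open>c < M\<close> by simp
  qed (use \<open>even M\<close> in \<open>simp add: transpose_def map_idI\<close>)
  have "pf A [0..<Suc (Suc M)] = - pf A (Suc M # [0..<Suc M])"
    using pf_move[of A "[]" "Suc M" "[0..<Suc M]" "[]", OF skew] \<open>even M\<close> by simp
  also have "\<dots> = - (\<Sum>c<Suc M. (- 1) ^ c * (A (Suc M) c * pf A ([0..<c] @ [Suc c..<Suc M])))"
    by (auto simp: alt_sum_eq_sum nth_append simp del: upt_Suc sum.lessThan_Suc intro!: sum.cong)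
  also have "\<dots> = (\<Sum>c<Suc M. A c (Suc M) * ((- 1) ^ c * pf A ([0..<c] @ [Suc c..<Suc M])))"
    unfolding sum_negf[symmetric] by (intro sum.cong refl) (simp add: skew[of "Suc M"])
  also have "\<dots> = (\<Sum>c<Suc M. A c (Suc M) *
      ((if M = c then 1 else - 1) * pf A (map (transpose M c) [0..<M])))"
    by (intro sum.cong refl) (simp add: remove del: upt_Suc)
  finally show ?thesis
    by (simp only: lessThan_Suc[symmetric] transpose_apply_first mult.left_commute)
qed

lemma pf_map_transpose:
  fixes A :: "nat \<Rightarrow> nat \<Rightarrow> real"
  assumes skew: "\<And>i j. A i j = - A j i" and "b < M"
  shows "pf A (map (transpose M b) [0..<Suc M]) = - pf A [0..<Suc M]"
proof -
  have upt: "[0..<Suc M] = [0..<b] @ b # [Suc b..<M] @ M # []"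
    using \<open>b < M\<close> upt_add_eq_append[of 0 b "M - b"] by (simp add: upt_conv_Cons)
  have "map (transpose M b) [0..<Suc M] = [0..<b] @ M # [Suc b..<M] @ b # []"
    unfolding upt using \<open>b < M\<close> by (auto simp: transpose_def intro!: map_idI)
  then show ?thesis
    unfolding upt using pf_exchange[of A "[0..<b]" M "[Suc b..<M]" b "[]", OF skew] by simp
qed

text \<open>For each \<open>b\<close> the sum over \<open>c\<close> is an expansion of the Pfaffian
  with rows and columns transposed by \<open>b\<close>. The sign of the transposition makes all
  \<open>2 * N + 2\<close> choices of \<open>b\<close> contribute equally, which supplies the new
  factor \<open>2 * (N + 1)\<close>. The induction is over all \<open>A\<close> because it is
  applied to transposed matrices.\<close>

lemma sum_permutes_eq_pf:
  fixes A :: "nat \<Rightarrow> nat \<Rightarrow> real"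
  assumes "\<And>i j. A i j = - A j i"
  shows "(\<Sum>p | p permutes {..<2 * N}. of_int (sign p) * (\<Prod>i<N. A (p (2 * i)) (p (2 * i + 1)))) =
    2 ^ N * fact N * pf A [0..<2 * N]"
  using assms
proof (induction N arbitrary: A)
  case 0
  show ?case by simp
next
  case (Suc N)
  define M where "M = 2 * N"
  define R where "R = (\<lambda>A :: nat \<Rightarrow> nat \<Rightarrow> real. \<Sum>q | q permutes {..<M}. of_int (sign q) *
      (\<Prod>i<N. A (q (2 * i)) (q (2 * i + 1))))"
  define s :: "nat \<Rightarrow> nat \<Rightarrow> real" where "s = (\<lambda>a b. if a = b then 1 else - 1)"
  let ?t = "\<lambda>b c x. transpose (Suc M) b (transpose M c x)"
  have R: "R (\<lambda>i j. A (?t b c i) (?t b c j)) =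
      2 ^ N * fact N * pf (\<lambda>i j. A (transpose (Suc M) b i) (transpose (Suc M) b j)) (map (transpose M c) [0..<M])"
    for b c
    unfolding R_def M_def by (subst Suc.IH, rule Suc.prems) (simp add: pf_map)
  have "(\<Sum>p | p permutes {..<2 * Suc N}. of_int (sign p) * (\<Prod>i<Suc N. A (p (2 * i)) (p (2 * i + 1)))) =
      (\<Sum>b\<in>insert (Suc M) {..<Suc M}. s (Suc M) b * (\<Sum>c\<in>insert M {..<M}. s M c *
        (\<Sum>q | q permutes {..<M}. of_int (sign q) *
          (\<Prod>i<Suc N. A (?t b c (q (2 * i))) (?t b c (q (2 * i + 1)))))))"
    using sum_sign_permutes_lessThan_Suc_Suc[where M = M and F = "\<lambda>p. \<Prod>i<Suc N. A (p (2 * i)) (p (2 * i + 1))"]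
    by (simp add: M_def s_def del: prod.lessThan_Suc)
  also have "\<dots> = (\<Sum>b\<in>insert (Suc M) {..<Suc M}. s (Suc M) b * (\<Sum>c\<in>insert M {..<M}. s M c *
        (A (?t b c M) (?t b c (Suc M)) * R (\<lambda>i j. A (?t b c i) (?t b c j)))))"
  proof (intro sum.cong refl arg_cong2[where f = "(*)"])
    fix b c
    show "(\<Sum>q | q permutes {..<M}. of_int (sign q) *
          (\<Prod>i<Suc N. A (?t b c (q (2 * i))) (?t b c (q (2 * i + 1))))) =
        A (?t b c M) (?t b c (Suc M)) * R (\<lambda>i j. A (?t b c i) (?t b c j))"
      unfolding R_def sum_distrib_left
    proof (intro sum.cong refl)
      fix q assume "q \<in> {q. q permutes {..<M}}"
      then have "q M = M" "q (Suc M) = Suc M"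
        by (auto intro: permutes_not_in)
      then show "of_int (sign q) * (\<Prod>i<Suc N. A (?t b c (q (2 * i))) (?t b c (q (2 * i + 1)))) =
          A (?t b c M) (?t b c (Suc M)) * (of_int (sign q) *
            (\<Prod>i<N. A (?t b c (q (2 * i))) (?t b c (q (2 * i + 1)))))"
        by (simp add: M_def)
    qed
  qed
  also have "\<dots> = (\<Sum>b\<in>insert (Suc M) {..<Suc M}. s (Suc M) b * (2 ^ N * fact N *
      pf (\<lambda>i j. A (transpose (Suc M) b i) (transpose (Suc M) b j)) [0..<Suc (Suc M)]))"
  proof (intro sum.cong refl arg_cong2[where f = "(*)"])
    fix b
    let ?A = "\<lambda>i j. A (transpose (Suc M) b i) (transpose (Suc M) b j)"
    have "(\<Sum>c\<in>insert M {..<M}. s M c *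
        (A (?t b c M) (?t b c (Suc M)) * R (\<lambda>i j. A (?t b c i) (?t b c j)))) =
      2 ^ N * fact N * (\<Sum>c\<in>insert M {..<M}. s M c *
        (?A (transpose M c M) (Suc M) * pf ?A (map (transpose M c) [0..<M])))"
      unfolding R sum_distrib_left
      by (intro sum.cong refl) (auto simp: algebra_simps transpose_def)
    also have "(\<Sum>c\<in>insert M {..<M}. s M c *
        (?A (transpose M c M) (Suc M) * pf ?A (map (transpose M c) [0..<M]))) = pf ?A [0..<Suc (Suc M)]"
      unfolding s_def by (rule pf_expand_last) (rule Suc.prems, simp add: M_def)
    finally show "(\<Sum>c\<in>insert M {..<M}. s M c *
        (A (?t b c M) (?t b c (Suc M)) * R (\<lambda>i j. A (?t b c i) (?t b c j)))) =
      2 ^ N * fact N * pf ?A [0..<Suc (Suc M)]" .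
  qed
  also have "\<dots> = (\<Sum>b\<in>insert (Suc M) {..<Suc M}. 2 ^ N * fact N * pf A [0..<Suc (Suc M)])"
  proof (intro sum.cong refl)
    fix b assume "b \<in> insert (Suc M) {..<Suc M}"
    then have "pf A (map (transpose (Suc M) b) [0..<Suc (Suc M)]) = s (Suc M) b * pf A [0..<Suc (Suc M)]"
      using pf_map_transpose[OF Suc.prems, of b "Suc M"] by (auto simp: s_def simp del: upt_Suc)
    then show "s (Suc M) b * (2 ^ N * fact N *
        pf (\<lambda>i j. A (transpose (Suc M) b i) (transpose (Suc M) b j)) [0..<Suc (Suc M)]) =
      2 ^ N * fact N * pf A [0..<Suc (Suc M)]"
      unfolding pf_map by (simp add: s_def del: upt_Suc)
  qed
  also have "\<dots> = 2 ^ Suc N * fact (Suc N) * pf A [0..<2 * Suc N]"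
    by (simp add: M_def algebra_simps del: upt_Suc)
  finally show ?case .
qed

lemma Pf_eq_pf:
  assumes "\<And>i j. m i j = - m j i"
  shows "Pf m b as = pf (entry m b) as"
proof -
  have skew: "entry m b x y = - entry m b y x" for x y
    by (cases x; cases y) (simp_all, rule assms)
  have "pf (\<lambda>i j. entry m b (as ! i) (as ! j)) [0..<length as] = pf (entry m b) as"
    using pf_map[of "entry m b" "(!) as" "[0..<length as]"] by (simp add: map_nth)
  with sum_permutes_eq_pf[of "\<lambda>i j. entry m b (as ! i) (as ! j)" "length as div 2", OF skew]
  show ?thesis
    by (auto simp: Pf_def pfaffian_def pf_odd)
qed

section \<open>Formal sums of symbols and the lattice equations\<close>

text \<open>To express the step in \<open>l\<close>, the symbols are enlarged to formal sums (lists) of symbols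
  together with one further symbol \<open>None\<close>, whose entry with \<open>Ix i\<close> is \<open>(- 1) ^ i\<close>.\<close>

fun ext_entry :: "(nat \<Rightarrow> nat \<Rightarrow> real) \<Rightarrow> (nat \<Rightarrow> real) \<Rightarrow> symb option \<Rightarrow> symb option \<Rightarrow> real" where
  "ext_entry m b (Some x) (Some y) = entry m b x y"
| "ext_entry m b None (Some (Ix i)) = (- 1) ^ i"
| "ext_entry m b (Some (Ix i)) None = - ((- 1) ^ i)"
| "ext_entry m b _ _ = 0"

definition form :: "(nat \<Rightarrow> nat \<Rightarrow> real) \<Rightarrow> (nat \<Rightarrow> real) \<Rightarrow> symb option list \<Rightarrow> symb option list \<Rightarrow> real" where
  "form m b xs ys = (\<Sum>x\<leftarrow>xs. \<Sum>y\<leftarrow>ys. ext_entry m b x y)"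

lemma form_skew:
  assumes "\<And>i j. m i j = - m j i"
  shows "form m b xs ys = - form m b ys xs"
proof -
  have skew: "ext_entry m b x y = - ext_entry m b y x" for x y
  proof -
    have "entry m b s t = - entry m b t s" for s t
      by (cases s; cases t) (simp_all, rule assms)
    moreover have "ext_entry m b None (Some s) = - ext_entry m b (Some s) None"
      "ext_entry m b (Some s) None = - ext_entry m b None (Some s)" for s
      by (cases s; simp)+
    moreover have "ext_entry m b None None = 0"
      by simp
    ultimately show ?thesis
      by (metis ext_entry.simps(1) minus_zero not_None_eq)
  qed
  have "form m b xs ys = (\<Sum>y\<leftarrow>ys. \<Sum>x\<leftarrow>xs. ext_entry m b x y)"
    unfolding form_def by (induction xs) (simp_all add: sum_list_addf)
  also have "\<dots> = - form m b ys xs"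
    unfolding form_def by (subst skew) (simp add: uminus_sum_list_map o_def)
  finally show ?thesis .
qed

theorem theorem3p34:
  fixes mu :: "nat \<Rightarrow> nat \<Rightarrow> nat \<Rightarrow> nat \<Rightarrow> real"
    and beta :: "nat \<Rightarrow> nat \<Rightarrow> nat \<Rightarrow> real"
    and tau v u w :: "nat \<Rightarrow> nat \<Rightarrow> nat \<Rightarrow> real"
  assumes mu_skew: "\<And>k l i j. mu k l i j = - mu k l j i"
    and mu_k: "\<And>k l i j. mu (k + 1) l i j =
          mu k l i j + Pf (mu k l) (beta k l) [D0, D1, Ix i, Ix j]"
    and beta_k: "\<And>k l i. beta (k + 1) l i = beta k l (i + 1) + beta k l i"
    and mu_l: "\<And>k l i j. mu k (l + 1) i j =
          mu k l i j + mu k l (i + 1) j + mu k l i (j + 1) + mu k l (i + 1) (j + 1)"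
    and beta_l: "\<And>k l i. beta k (l + 1) i = beta k l (i + 1) + beta k l i"
    and tau_even: "\<And>n k l. tau (2 * n) k l = Pf (mu k l) (beta k l) (map Ix [0..<2 * n])"
    and tau_odd: "\<And>n k l. tau (2 * n + 1) k l =
          Pf (mu k l) (beta k l) (D0 # map Ix [0..<2 * n + 1])"
    and tau_nz: "\<And>n k l. tau n k l \<noteq> 0"
    and v: "\<And>n k l. v n k l = tau (n + 1) k l / tau n k l"
    and u: "\<And>n k l. u n k l = tau n (k + 1) l / tau n k l"
    and w: "\<And>n k l. w n k l = tau n k (l + 1) / tau n k l"
  shows "\<forall>n k l.
      v n (k + 1) l * u n k l = v n k l * u (n + 1) k l \<and>
      v n k (l + 1) * w n k l = v n k l * w (n + 1) k l \<and>
      u (n + 1) k (l + 1) / u (n + 1) k l =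
        1 + (v (n + 1) k l * w n (k + 1) l) / (w (n + 1) k l * v n (k + 1) l)
          - v (n + 1) (k + 1) l / v n k (l + 1)"
proof -
  have tau_bilinear: "tau (n + 1) (k + 1) (l + 1) * tau (n + 1) k l =
      tau (n + 1) k (l + 1) * tau (n + 1) (k + 1) l + tau (n + 2) k l * tau n (k + 1) (l + 1)
        - tau (n + 2) (k + 1) l * tau n k (l + 1)" for n k l
  proof -
    define E where "E = form (mu k l) (beta k l)"
    define x where "x = (\<lambda>i. [Some (Ix i)])"
    define y where "y = (\<lambda>i. [Some (Ix i), Some (Ix (Suc i))])"
    let ?d0 = "[Some D0]" and ?d1 = "[Some D1]" and ?c = "[None] :: symb option list"
    define X where "X = (\<lambda>n. map x [0..<n])"
    define Y where "Y = (\<lambda>n. map y [0..<n])"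
    note defs = E_def form_def x_def y_def
    note pf.simps [simp del] upt_Suc [simp del]
    have skew: "E s t = - E t s" for s t
      unfolding E_def by (rule form_skew) (rule mu_skew)
    have d01: "E ?d0 ?d1 = 0" "E ?c ?d0 = 0" "E ?c ?d1 = 0" "E ?c (x i) = (- 1) ^ i" for i
      by (simp_all add: defs)
    have sums: "E (y i) z = E (x i) z + E (x (Suc i)) z" for i z
      by (simp add: defs)
    have mu': "mu (k + 1) l i j = mu k l i j + beta k l (i + 1) * beta k l j - beta k l i * beta k l (j + 1)"
      for k l i j
      using mu_k Pf_d0_d1[of "mu k l", OF mu_skew] by simp
    have odd_tau: "tau (Suc (2 * m)) k l = pf (entry (mu k l) (beta k l)) (D0 # map Ix [0..<Suc (2 * m)])"
      and even_tau: "tau (2 * m) k l = pf (entry (mu k l) (beta k l)) (map Ix [0..<2 * m])" for m k l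
      using tau_even tau_odd Pf_eq_pf[of "mu k l", OF mu_skew] by simp_all
    have T0: "pf (entry (mu k l) (beta k l)) (map Ix [0..<n]) = pf E (X n)"
      "pf (entry (mu k l) (beta k l)) (D0 # map Ix [0..<n]) = pf E (?d0 # X n)" for n
      unfolding X_def
      by (simp_all add: pf_map defs)
        (intro pf_Cons_map_cong; simp add: defs)
    \<comment> \<open>\<open>mu_l\<close> and \<open>beta_l\<close> say that the entries at
      \<open>l + 1\<close> are those of the sums \<open>y i\<close> at \<open>l\<close>.\<close>
    have Tl: "pf (entry (mu k (l + 1)) (beta k (l + 1))) (map Ix [0..<n]) = pf E (Y n)"
      "pf (entry (mu k (l + 1)) (beta k (l + 1))) (D0 # map Ix [0..<n]) = pf E (?d0 # Y n)" for n
      unfolding Y_def pf_map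
      by (rule pf_cong, simp add: defs mu_l[simplified])
        (intro pf_Cons_map_cong; simp add: defs mu_l[simplified] beta_l[simplified])
    have Tk: "pf (entry (mu (k + 1) l) (beta (k + 1) l)) (map Ix [0..<n]) = pf E (X n) + pf E (?d0 # ?d1 # X n)"
      "pf (entry (mu (k + 1) l) (beta (k + 1) l)) (D0 # map Ix [0..<n]) = pf E (?d0 # X n) + pf E (?d1 # X n)"
      for n
      unfolding X_def
       apply (rule pf_rank_two_update_map[of E, OF skew d01(1)], simp add: defs mu'[simplified])
      apply (rule pf_rank_two_update_Cons_map[of E, OF skew d01(1)])
       apply (simp_all add: defs mu'[simplified] beta_k[simplified])
      done
    \<comment> \<open>The step in \<open>k\<close> now starts from \<open>(k, l + 1)\<close>; its
      update vectors are the entries of \<open>D0\<close> and \<open>D1\<close> with the sums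
      \<open>y i\<close>.\<close>
    have Tkl: "pf (entry (mu (k + 1) (l + 1)) (beta (k + 1) (l + 1))) (map Ix [0..<n]) =
        pf E (Y n) + pf E (?d0 # ?d1 # Y n)"
      "pf (entry (mu (k + 1) (l + 1)) (beta (k + 1) (l + 1))) (D0 # map Ix [0..<n]) =
        pf E (?d0 # Y n) + pf E (?d1 # Y n)" for n
      unfolding Y_def
       apply (rule pf_rank_two_update_map[of E, OF skew d01(1)],
          simp add: defs mu'[simplified] mu_l[simplified] beta_l[simplified] algebra_simps)
      apply (rule pf_rank_two_update_Cons_map[of E, OF skew d01(1)])
       apply (simp_all add: defs mu'[simplified] mu_l[simplified] beta_k[simplified] beta_l[simplified] algebra_simps)
      done
    note pluecker = pf_pluecker_consecutive_sums[of E ?c x ?d0 ?d1 y n, OF skew d01(4,2,3) sums]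
    show ?thesis
    proof (cases "even n")
      case True
      then obtain m where m: "n = 2 * m" by blast
      have "tau n k' l' = pf (entry (mu k' l') (beta k' l')) (map Ix [0..<n])"
        "tau (n + 1) k' l' = pf (entry (mu k' l') (beta k' l')) (D0 # map Ix [0..<n + 1])"
        "tau (n + 2) k' l' = pf (entry (mu k' l') (beta k' l')) (map Ix [0..<n + 2])" for k' l'
        using even_tau[of m] odd_tau[of m] even_tau[of "Suc m"] by (simp_all add: m)
      with pluecker(1)[OF True] show ?thesis
        \<comment> \<open>After substitution the products without \<open>D1\<close> cancel, and the
          Pluecker relation remains.\<close>
        by (simp only: T0 Tl Tk Tkl) (simp add: X_def Y_def algebra_simps)
    next
      case False
      then obtain m where m: "n = Suc (2 * m)" by (auto elim: oddE)
      have "tau n k' l' = pf (entry (mu k' l') (beta k' l')) (D0 # map Ix [0..<n])"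
        "tau (n + 1) k' l' = pf (entry (mu k' l') (beta k' l')) (map Ix [0..<n + 1])"
        "tau (n + 2) k' l' = pf (entry (mu k' l') (beta k' l')) (D0 # map Ix [0..<n + 2])" for k' l'
        using odd_tau[of m] even_tau[of "Suc m"] odd_tau[of "Suc m"] by (simp_all add: m)
      with pluecker(2)[OF False] show ?thesis
        by (simp only: T0 Tl Tk Tkl) (simp add: X_def Y_def algebra_simps)
    qed
  qed
  show ?thesis
  proof (intro allI conjI)
    fix n k l
    show "v n (k + 1) l * u n k l = v n k l * u (n + 1) k l"
      "v n k (l + 1) * w n k l = v n k l * w (n + 1) k l"
      using tau_nz by (simp_all add: u v w)
    have "u (n + 1) k (l + 1) / u (n + 1) k l =
        tau (n + 1) (k + 1) (l + 1) * tau (n + 1) k l / (tau (n + 1) k (l + 1) * tau (n + 1) (k + 1) l)"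
      by (simp add: u)
    also have "\<dots> = 1 + tau (n + 2) k l * tau n (k + 1) (l + 1) / (tau (n + 1) k (l + 1) * tau (n + 1) (k + 1) l)
        - tau (n + 2) (k + 1) l * tau n k (l + 1) / (tau (n + 1) k (l + 1) * tau (n + 1) (k + 1) l)"
      unfolding tau_bilinear using tau_nz by (simp add: add_divide_distrib diff_divide_distrib)
    also have "\<dots> = 1 + (v (n + 1) k l * w n (k + 1) l) / (w (n + 1) k l * v n (k + 1) l)
          - v (n + 1) (k + 1) l / v n k (l + 1)"
      using tau_nz by (simp add: v w)
    finally show "u (n + 1) k (l + 1) / u (n + 1) k l =
        1 + (v (n + 1) k l * w n (k + 1) l) / (w (n + 1) k l * v n (k + 1) l)
          - v (n + 1) (k + 1) l / v n k (l + 1)" .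
  qed
qed

end
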